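(* Let $H$ be a closed subgroup of a compact group $G$ and $n\ge1$. Then $d^{(n)}(H,G)\le d^{(n)}(H)$.
   Context: For a compact group $X$, $\mu_X$ denotes its normalized Haar measure and $\mu_X^m$ the product measure on $X^m$. Commutators: $[x,y]=x^{-1}y^{-1}xy$, $[x_1]=x_1$, $[x_1,\dots,x_{k+1}]=[[x_1,\dots,x_k],x_{k+1}]$. For a compact group $X$ and $n\ge1$, $d^{(n)}(X)=\mu_X^{n+1}(\{(x_1,\dots,x_{n+1})\in X^{n+1}: [x_1,\dots,x_{n+1}]=1\})$ (the $n$-th nilpotency degree). For a closed subgroup $H$ of $G$, $d^{(n)}(H,G)=(\mu_H^n\times\mu_G)(\{(h_1,\dots,h_n,g)\in H^n\times G: [h_1,\dots,h_n,g]=1\})$ (the relative $n$-th nilpotency degree). *)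

theory Defs
  imports "HOL-Analysis.Analysis" "HOL-Library.Function_Algebras"
begin

text \<open>Groups are written additively via the (not necessarily commutative) class group_add:
  x + y is the group product, -x the inverse, 0 the identity.\<close>

definition comm :: "'a::group_add \<Rightarrow> 'a \<Rightarrow> 'a" where
  "comm x y = - x + - y + x + y"

fun ncomm :: "'a::group_add list \<Rightarrow> 'a" where
  "ncomm [] = 0"
| "ncomm (x # xs) = foldl comm x xs"

definition compact_group_type :: "'a::{group_add,t2_space} itself \<Rightarrow> bool" where
  "compact_group_type _ \<longleftrightarrow> compact (UNIV :: 'a set)
     \<and> continuous_on UNIV (\<lambda>p::'a \<times> 'a. fst p + snd p)
     \<and> continuous_on UNIV (\<lambda>x::'a. - x)"

definition closed_subgroup :: "'a::{group_add,topological_space} set \<Rightarrow> bool" where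
  "closed_subgroup H \<longleftrightarrow> closed H \<and> 0 \<in> H \<and> (\<forall>x\<in>H. \<forall>y\<in>H. x + y \<in> H) \<and> (\<forall>x\<in>H. - x \<in> H)"

text \<open>M is the normalized Haar measure of the compact group K (a compact subgroup of the
  ambient type, with the subspace topology): a left-invariant Radon probability measure on the
  Borel sets of K.\<close>
definition normalized_haar :: "'b::{group_add,topological_space} set \<Rightarrow> 'b measure \<Rightarrow> bool" where
  "normalized_haar K M \<longleftrightarrow>
     space M = K \<and> sets M = sets (restrict_space borel K) \<and> emeasure M K = 1
     \<and> (\<forall>g\<in>K. \<forall>A\<in>sets M. emeasure M ((\<lambda>x. g + x) ` A) = emeasure M A)
     \<and> (\<forall>A\<in>sets M. emeasure M A = (INF U\<in>{U. openin (top_of_set K) U \<and> A \<subseteq> U}. emeasure M U))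
     \<and> (\<forall>U. openin (top_of_set K) U \<longrightarrow>
            emeasure M U = (SUP C\<in>{C. compact C \<and> C \<subseteq> U}. emeasure M C))"

text \<open>H^n \<times> G, realised as tuples (h_1,...,h_n,g) = (f 0, ..., f (n-1), f n) inside nat \<Rightarrow> 'a
  (product topology), with f i = 0 for i > n.\<close>
definition rel_tuples :: "'a::group_add set \<Rightarrow> nat \<Rightarrow> (nat \<Rightarrow> 'a) set" where
  "rel_tuples H n = {f. (\<forall>i<n. f i \<in> H) \<and> (\<forall>i>n. f i = 0)}"

definition pow_tuples :: "'a::group_add set \<Rightarrow> nat \<Rightarrow> (nat \<Rightarrow> 'a) set" where
  "pow_tuples H n = {f. (\<forall>i\<le>n. f i \<in> H) \<and> (\<forall>i>n. f i = 0)}"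

definition comm_degree :: "nat \<Rightarrow> (nat \<Rightarrow> 'a::group_add) set \<Rightarrow> (nat \<Rightarrow> 'a) measure \<Rightarrow> real" where
  "comm_degree n K M = measure M {f \<in> K. ncomm (map f [0..<Suc n]) = 0}"

end

theory Submission
  imports Defs
begin

text \<open>
  Fix \<open>p = (h\<^sub>1, \<dots>, h\<^sub>n)\<close> and let \<open>C\<close> be the centralizer of \<open>[h\<^sub>1, \<dots>, h\<^sub>n]\<close> in \<open>G\<close>. Elements of \<open>H\<close>
  in distinct cosets of \<open>C \<inter> H\<close> lie in distinct cosets of \<open>C\<close>, so \<open>[H : C \<inter> H] \<le> [G : C]\<close>: the fibre
  of the commuting set over \<open>p\<close> is at most as large in \<open>G\<close> as it is in \<open>H\<close>.

  No product measure is used to integrate this over \<open>H\<^sup>n\<close>. A finite set \<open>S \<subseteq> H\<close> in distinct cosets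
  of \<open>C\<close> stays in distinct cosets of the centralizers over a neighbourhood of \<open>p\<close>, so over that
  neighbourhood the translates by \<open>S\<close> of the commuting set in \<open>H\<^sup>n \<times> G\<close> are disjoint. If \<open>S\<close> is a full
  transversal, the translates of any open neighbourhood of the commuting set in \<open>H\<^sup>n \<times> H\<close> cover;
  otherwise \<open>S\<close> can be taken arbitrarily large. Compactness of \<open>H\<^sup>n\<close> and outer regularity conclude,
  provided that both Haar measures have the same marginal on \<open>H\<^sup>n\<close>. This is uniqueness of Haar
  measure, for which it is enough that \<open>\<mu> C \<le> \<nu> (- U)\<close> for closed \<open>C\<close> inside open \<open>U\<close>.
\<close>

section \<open>Compact topological groups and their function spaces\<close>

text \<open>Unlike \<^const>\<open>compact_group_type\<close> this does not ask for the class \<^class>\<open>t2_space\<close>, of which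
  function types are not an instance.\<close>
definition compact_top_group :: "'b::{group_add,topological_space} itself \<Rightarrow> bool" where
  "compact_top_group _ \<longleftrightarrow> compact (UNIV :: 'b set)
     \<and> continuous_on UNIV (\<lambda>p::'b \<times> 'b. fst p + snd p)
     \<and> continuous_on UNIV (\<lambda>x::'b. - x)"

text \<open>Hausdorffness of the factors passes to the abstract product topology. This is needed
  where the image of a compact set of tuples must be closed.\<close>

lemma compact_imp_closed_fun:
  assumes "compact (C :: ('i \<Rightarrow> 'a::t2_space) set)"
  shows "closed C"
proof -
  have "Hausdorff_space (euclidean :: ('i \<Rightarrow> 'a) topology)"
    unfolding euclidean_product_topology[symmetric] Hausdorff_space_product_topology
    by (auto simp: Hausdorff_space_def disjnt_def dest!: hausdorff)
  then show ?thesis using assms compactin_imp_closedin[of euclidean C] by simp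
qed

text \<open>Tychonoff gives compactness, and continuity is checked by coordinates. The measures on
  tuples can thus be treated as Haar measures of subgroups of one function group.\<close>

lemma compact_top_group_fun:
  assumes "compact_group_type TYPE('a::{group_add,t2_space})"
  shows "compact_top_group TYPE('i \<Rightarrow> 'a)"
proof -
  have cp: "continuous_on UNIV (\<lambda>p::'a \<times> 'a. fst p + snd p)"
    and cm: "continuous_on UNIV (\<lambda>x::'a. - x)" and co: "compact (UNIV :: 'a set)"
    using assms by (auto simp: compact_group_type_def)
  have "compact_space (product_topology (\<lambda>_::'i. euclidean :: 'a topology) UNIV)"
    using co by (subst compact_space_product_topology) (simp add: compact_space_def)
  then have "compact (UNIV :: ('i \<Rightarrow> 'a) set)"
    by (simp add: euclidean_product_topology compact_space_def)
  moreover have "continuous_on UNIV (\<lambda>p::('i \<Rightarrow> 'a) \<times> ('i \<Rightarrow> 'a). fst p + snd p)"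
  proof (rule continuous_on_coordinatewise_then_product)
    fix i
    have "continuous_on UNIV (\<lambda>p::('i \<Rightarrow> 'a) \<times> ('i \<Rightarrow> 'a). (fst p i, snd p i))"
      by (intro continuous_intros continuous_on_product_then_coordinatewise)
    from continuous_on_compose2[OF cp this]
    show "continuous_on UNIV (\<lambda>p::('i \<Rightarrow> 'a) \<times> ('i \<Rightarrow> 'a). (fst p + snd p) i)"
      by simp
  qed
  moreover have "continuous_on UNIV (\<lambda>x::'i \<Rightarrow> 'a. - x)"
  proof (rule continuous_on_coordinatewise_then_product)
    fix i
    show "continuous_on UNIV (\<lambda>x::'i \<Rightarrow> 'a. (- x) i)"
      using continuous_on_compose2[OF cm continuous_on_product_coordinates[of i]] by simp
  qed
  ultimately show ?thesis by (simp add: compact_top_group_def)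
qed


lemma compact_group_continuous_add:
  fixes f g :: "'c::topological_space \<Rightarrow> 'b::{group_add,topological_space}"
  assumes "compact_top_group TYPE('b)" "continuous_on S f" "continuous_on S g"
  shows "continuous_on S (\<lambda>x. f x + g x)"
proof -
  have "continuous_on UNIV (\<lambda>p::'b \<times> 'b. fst p + snd p)"
    using assms(1) by (simp add: compact_top_group_def)
  from continuous_on_compose2[OF this continuous_on_Pair[OF assms(2,3)]] show ?thesis by simp
qed

lemma compact_group_continuous_minus:
  fixes f :: "'c::topological_space \<Rightarrow> 'b::{group_add,topological_space}"
  assumes "compact_top_group TYPE('b)" "continuous_on S f"
  shows "continuous_on S (\<lambda>x. - f x)"
proof -
  have "continuous_on UNIV (\<lambda>x::'b. - x)"
    using assms(1) by (simp add: compact_top_group_def)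
  from continuous_on_compose2[OF this assms(2)] show ?thesis by simp
qed

lemma translate_eq_vimage: "(\<lambda>x. g + x) ` A = (\<lambda>x::'b::group_add. - g + x) -` A"
proof (intro equalityI subsetI)
  fix x assume "x \<in> (\<lambda>x. - g + x) -` A"
  then show "x \<in> (\<lambda>x. g + x) ` A" by (intro image_eqI[of _ _ "- g + x"]) (auto simp: add.assoc[symmetric])
qed (auto simp: add.assoc[symmetric])

lemma uminus_image_eq_vimage: "uminus ` A = uminus -` (A :: 'b::group_add set)"
proof (intro equalityI subsetI)
  fix x assume "x \<in> uminus -` A"
  then show "x \<in> uminus ` A" by (intro image_eqI[of _ _ "- x"]) auto
qed auto

text \<open>Each new set is removed from the cells built before it. Together with compactness, such
  partitions let finite sums play the role of integrals.\<close>

lemma finite_cover_refine_partition: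
  assumes "finite T" "\<forall>t\<in>T. V t \<in> sets M"
  shows "\<exists>B. (\<forall>t\<in>T. B t \<in> sets M \<and> B t \<subseteq> V t) \<and> disjoint_family_on B T
           \<and> (\<Union>t\<in>T. B t) = (\<Union>t\<in>T. V t)"
  using assms
proof (induction T rule: finite_induct)
  case empty
  then show ?case by (auto simp: disjoint_family_on_def)
next
  case (insert a T)
  then obtain B where B: "\<forall>t\<in>T. B t \<in> sets M \<and> B t \<subseteq> V t" "disjoint_family_on B T"
      "(\<Union>t\<in>T. B t) = (\<Union>t\<in>T. V t)"
    by auto
  define B' where "B' = (\<lambda>t. if t = a then V a else B t - V a)"
  have "(\<forall>t\<in>insert a T. B' t \<in> sets M \<and> B' t \<subseteq> V t)"
    using B(1) insert by (auto simp: B'_def)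
  moreover have "disjoint_family_on B' (insert a T)"
    using B(2) insert(2) by (auto simp: B'_def disjoint_family_on_def)
  moreover have "(\<Union>t\<in>insert a T. B' t) = (\<Union>t\<in>insert a T. V t)"
  proof -
    have "(\<Union>t\<in>insert a T. B' t) = V a \<union> ((\<Union>t\<in>T. B t) - V a)"
      using insert(2) by (auto simp: B'_def)
    then show ?thesis using B(3) by auto
  qed
  ultimately show ?case by blast
qed

section \<open>Invariant probability measures on closed subgroups\<close>

text \<open>Regularity is kept out: counting translates, and one side of the comparison behind
  uniqueness, rest on invariance alone.\<close>

locale invariant_prob =
  fixes K :: "'b::{group_add,topological_space} set" and M :: "'b measure"
  assumes group: "compact_top_group TYPE('b)"
    and subgroup: "closed_subgroup K"
    and space_eq: "space M = K"
    and sets_eq: "sets M = sets (restrict_space borel K)"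
    and emeasure_K: "emeasure M K = 1"
    and emeasure_translate:
      "\<And>g A. g \<in> K \<Longrightarrow> A \<in> sets M \<Longrightarrow> emeasure M ((\<lambda>x. g + x) ` A) = emeasure M A"

sublocale invariant_prob \<subseteq> finite_measure M
  by (rule finite_measureI) (simp add: space_eq emeasure_K)

context invariant_prob
begin

lemma subgroupD:
  "closed K" "0 \<in> K" "\<And>x y. x \<in> K \<Longrightarrow> y \<in> K \<Longrightarrow> x + y \<in> K" "\<And>x. x \<in> K \<Longrightarrow> - x \<in> K"
  using subgroup by (auto simp: closed_subgroup_def)

lemma compact_K: "compact K"
  using group subgroupD(1) compact_Int_closed[of UNIV K] by (simp add: compact_top_group_def)

lemma sets_iff: "A \<in> sets M \<longleftrightarrow> A \<subseteq> K \<and> A \<in> sets borel"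
  unfolding sets_eq using subgroupD(1) by (subst sets_restrict_space_iff) auto

lemma measure_K: "measure M K = 1"
  by (simp add: measure_def emeasure_K)

lemma measure_translate:
  "g \<in> K \<Longrightarrow> A \<in> sets M \<Longrightarrow> measure M ((\<lambda>x. g + x) ` A) = measure M A"
  by (simp add: measure_def emeasure_translate)

lemma translate_in_sets:
  assumes "g \<in> K" "A \<in> sets M"
  shows "(\<lambda>x. g + x) ` A \<in> sets M"
proof -
  have "(\<lambda>x. - g + x) \<in> borel_measurable borel"
    by (intro borel_measurable_continuous_onI compact_group_continuous_add[OF group] continuous_intros)
  from measurable_sets[OF this, of A] have "(\<lambda>x. g + x) ` A \<in> sets borel"
    using assms by (simp add: sets_iff translate_eq_vimage)
  then show ?thesis using assms subgroupD(3) by (auto simp: sets_iff)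
qed

text \<open>Packing by disjoint translates. With its covering counterpart
  \<open>measure_le_card_mult\<close> it is how the index of a centralizer enters the
  estimates.\<close>

lemma card_mult_measure_le:
  assumes "finite S" "e ` S \<subseteq> K" "X \<in> sets M" "Y \<in> sets M"
    and "\<And>s. s \<in> S \<Longrightarrow> (\<lambda>x. e s + x) ` X \<subseteq> Y"
    and "disjoint_family_on (\<lambda>s. (\<lambda>x. e s + x) ` X) S"
  shows "card S * measure M X \<le> measure M Y"
proof -
  have "card S * measure M X = (\<Sum>s\<in>S. measure M ((\<lambda>x. e s + x) ` X))"
    using assms by (simp add: measure_translate image_subset_iff)
  also have "\<dots> = measure M (\<Union>s\<in>S. (\<lambda>x. e s + x) ` X)"
    using assms translate_in_sets by (intro finite_measure_finite_Union[symmetric]) auto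
  also have "\<dots> \<le> measure M Y"
    using assms by (intro finite_measure_mono) auto
  finally show ?thesis .
qed

lemma measure_le_card_mult:
  assumes "finite S" "e ` S \<subseteq> K" "X \<in> sets M"
    and "Y \<subseteq> (\<Union>s\<in>S. (\<lambda>x. e s + x) ` X)"
  shows "measure M Y \<le> card S * measure M X"
proof -
  have im: "(\<lambda>x. e s + x) ` X \<in> sets M" if "s \<in> S" for s
    using assms that translate_in_sets by auto
  have "measure M Y \<le> measure M (\<Union>s\<in>S. (\<lambda>x. e s + x) ` X)"
    using assms im by (intro finite_measure_mono) auto
  also have "\<dots> \<le> (\<Sum>s\<in>S. measure M ((\<lambda>x. e s + x) ` X))"
    using assms im by (intro measure_UNION_le) auto
  also have "\<dots> = card S * measure M X"
    using assms by (simp add: measure_translate image_subset_iff)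
  finally show ?thesis .
qed

end

section \<open>Uniqueness of Haar measure\<close>

text \<open>Outer regularity at closed sets is enough for uniqueness, and it can be established for
  images under homomorphisms.\<close>

locale haar_prob = invariant_prob +
  assumes outer_regular_closed: "\<And>C e. closed C \<Longrightarrow> C \<subseteq> K \<Longrightarrow> 0 < e \<Longrightarrow>
    \<exists>U. open U \<and> C \<subseteq> U \<and> measure M (U \<inter> K) < measure M C + e"

text \<open>Formally, integrate \<open>indicator C (- y + x)\<close> over both variables:
  integrating first in \<open>x\<close> gives the measure of \<open>C\<close> under
  \<open>M\<close>, first in \<open>y\<close> that of the inverse of \<open>C\<close> under
  \<open>N\<close>. Making \<open>y\<close> discrete perturbs \<open>- y + x\<close>, which is why
  \<open>C\<close> is thickened to \<open>U\<close>.\<close>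

lemma invariant_measure_le_inverse_open:
  fixes K :: "'b::{group_add,topological_space} set"
  assumes "invariant_prob K M" "invariant_prob K N" "closed C" "C \<subseteq> K" "open U" "C \<subseteq> U"
  shows "measure M C \<le> measure N (uminus ` (U \<inter> K))"
proof -
  interpret M: invariant_prob K M by fact
  interpret N: invariant_prob K N by fact
  note [continuous_intros] = compact_group_continuous_add[OF M.group] compact_group_continuous_minus[OF M.group]
  have compC: "compact C"
    using M.compact_K assms(3,4) by (metis compact_Int_closed inf.absorb_iff2)
  \<comment> \<open>Replacing a point of \<open>V\<close> by its representative \<open>y\<close>
    moves points of \<open>C\<close> no further than into \<open>U\<close>; compactness of
    \<open>C\<close> makes this uniform.\<close>
  have "\<exists>V. y \<in> V \<and> open V \<and> V \<times> C \<subseteq> {p. - fst p + y + snd p \<in> U}" for y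
  proof (rule Elementary_Topology.tube_lemma[OF compC])
    have "continuous_on UNIV (\<lambda>p. - fst p + y + snd p)" by (intro continuous_intros)
    from open_vimage[OF assms(5) this] show "open {p. - fst p + y + snd p \<in> U}"
      by (simp add: vimage_def)
  qed (use assms(6) in auto)
  then have "\<forall>y. \<exists>V. y \<in> V \<and> open V \<and> V \<times> C \<subseteq> {p. - fst p + y + snd p \<in> U}"
    by (rule allI)
  from choice[OF this] obtain V where V: "\<And>y. y \<in> V y" "\<And>y. open (V y)"
      "\<And>y. V y \<times> C \<subseteq> {p. - fst p + y + snd p \<in> U}"
    by auto
  obtain T where T: "T \<subseteq> K" "finite T" "K \<subseteq> (\<Union>t\<in>T. V t)"
    by (rule compactE_image[OF M.compact_K, of K V]) (use V(1,2) in auto)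
  have "\<forall>t\<in>T. V t \<inter> K \<in> sets N"
    using V(2) N.subgroupD(1) by (auto simp: N.sets_iff)
  from finite_cover_refine_partition[OF T(2) this]
  obtain B where B0: "\<forall>t\<in>T. B t \<in> sets N \<and> B t \<subseteq> V t \<inter> K"
    and B: "disjoint_family_on B T" "(\<Union>t\<in>T. B t) = (\<Union>t\<in>T. V t \<inter> K)"
    by (elim exE conjE)
  have UK: "(\<Union>t\<in>T. B t) = K" using B(2) T by auto
  have "(\<Sum>t\<in>T. measure N (B t)) = measure N (\<Union>t\<in>T. B t)"
    using B B0 T by (intro N.finite_measure_finite_Union[symmetric]) auto
  then have sum1: "(\<Sum>t\<in>T. measure N (B t)) = 1" by (simp add: UK N.measure_K)
  have Cs: "C \<in> sets M" using assms by (auto simp: M.sets_iff)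
  have UKs: "uminus ` (U \<inter> K) \<in> sets N"
  proof -
    have "uminus \<in> borel_measurable (borel :: 'b measure)"
      by (intro borel_measurable_continuous_onI continuous_intros)
    moreover have "U \<inter> K \<in> sets borel" using assms M.subgroupD(1) by auto
    ultimately have "uminus ` (U \<inter> K) \<in> sets borel"
      using measurable_sets[of uminus borel borel "U \<inter> K"] by (simp add: uminus_image_eq_vimage)
    then show ?thesis using N.subgroupD(4) by (auto simp: N.sets_iff)
  qed
  \<comment> \<open>Replaces the double integral of \<open>indicator C (- y + x)\<close>: \<open>P\<close> averages over \<open>y\<close> with respect to \<open>N\<close>,
      with \<open>y\<close> moved to the representative of its cell.\<close>
  define P where "P x = (\<Sum>t\<in>T. measure N (B t) * indicator ((\<lambda>x. t + x) ` C) x)" for x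
  have Ct: "(\<lambda>x. t + x) ` C \<in> sets M" if "t \<in> T" for t
    using that T Cs M.translate_in_sets by auto
  have P_le: "P x \<le> measure N (uminus ` (U \<inter> K))" if x: "x \<in> K" for x
  proof -
    define T' where "T' = {t\<in>T. - t + x \<in> C}"
    have "P x = (\<Sum>t\<in>T'. measure N (B t))"
      unfolding P_def T'_def sum.inter_filter[OF T(2)]
      by (intro sum.cong) (auto simp: translate_eq_vimage indicator_def)
    also have "\<dots> = measure N (\<Union>t\<in>T'. B t)"
      using B B0 T by (intro N.finite_measure_finite_Union[symmetric])
        (auto simp: T'_def disjoint_family_on_def)
    also have "\<dots> \<le> measure N ((\<lambda>z. x + z) ` (uminus ` (U \<inter> K)))"
    proof (rule N.finite_measure_mono)
      show "(\<lambda>z. x + z) ` (uminus ` (U \<inter> K)) \<in> sets N"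
        using x UKs by (rule N.translate_in_sets)
      show "(\<Union>t\<in>T'. B t) \<subseteq> (\<lambda>z. x + z) ` (uminus ` (U \<inter> K))"
      proof
        fix y assume "y \<in> (\<Union>t\<in>T'. B t)"
        then obtain t where t: "t \<in> T" "- t + x \<in> C" "y \<in> V t" "y \<in> K"
          using B0 by (auto simp: T'_def)
        then have "- y + t + (- t + x) \<in> U" using V(3)[of t] by auto
        then have "- y + x \<in> U" by (simp add: add.assoc)
        moreover have "- y + x \<in> K" using t x N.subgroupD by auto
        ultimately show "y \<in> (\<lambda>z. x + z) ` (uminus ` (U \<inter> K))"
          by (simp add: translate_eq_vimage uminus_image_eq_vimage minus_add)
      qed
    qed
    also have "\<dots> = measure N (uminus ` (U \<inter> K))" using x UKs by (rule N.measure_translate)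
    finally show ?thesis .
  qed
  have int: "integrable M (\<lambda>x. measure N (B t) * indicator ((\<lambda>x. t + x) ` C) x :: real)"
    if "t \<in> T" for t
    using Ct[OF that] by (intro integrable_mult_right integrable_real_indicator) (auto simp: M.emeasure_finite less_top[symmetric])
  \<comment> \<open>The weights sum to 1 and all translates of \<open>C\<close> have equal measure,
    so the mean of \<open>P\<close> under \<open>M\<close> is the measure of \<open>C\<close>, while
    \<open>P_le\<close> bounds \<open>P\<close> pointwise.\<close>
  have "measure M C = (\<Sum>t\<in>T. measure N (B t)) * measure M C" by (simp add: sum1)
  also have "\<dots> = (\<Sum>t\<in>T. measure N (B t) * measure M ((\<lambda>x. t + x) ` C))"
    unfolding sum_distrib_right using T Cs by (intro sum.cong refl) (subst M.measure_translate, auto)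
  also have "\<dots> = (\<integral>x. P x \<partial>M)"
    unfolding P_def using int Ct by (subst Bochner_Integration.integral_sum) (auto intro!: sum.cong)
  also have "\<dots> \<le> (\<integral>x. measure N (uminus ` (U \<inter> K)) \<partial>M)"
    using P_le int by (intro integral_mono) (auto simp: P_def M.space_eq)
  also have "\<dots> = measure N (uminus ` (U \<inter> K))" by (simp add: M.space_eq M.measure_K)
  finally show ?thesis .
qed

text \<open>The thickening is removed by outer regularity of \<open>N\<close> at the inverse of
  \<open>C\<close>: the inverse of a neighbourhood of that set is an open set around
  \<open>C\<close>.\<close>

lemma invariant_measure_le_inverse_closed:
  fixes K :: "'b::{group_add,topological_space} set"
  assumes "invariant_prob K M" "haar_prob K N" "closed C" "C \<subseteq> K"
  shows "measure M C \<le> measure N (uminus ` C)"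
proof (rule field_le_epsilon)
  interpret N: haar_prob K N by fact
  note [continuous_intros] = compact_group_continuous_minus[OF N.group]
  have cont: "continuous_on UNIV (\<lambda>x::'b. - x)" by (intro continuous_intros)
  fix e :: real assume "0 < e"
  moreover have "closed (uminus ` C)"
    unfolding uminus_image_eq_vimage using assms(3) cont by (intro closed_vimage)
  moreover have "uminus ` C \<subseteq> K" using assms(4) N.subgroupD(4) by auto
  ultimately obtain U where U: "open U" "uminus ` C \<subseteq> U"
      "measure N (U \<inter> K) < measure N (uminus ` C) + e"
    using N.outer_regular_closed[of "uminus ` C" e] by auto
  have "- x \<in> K \<longleftrightarrow> x \<in> K" for x
    using N.subgroupD(4)[of x] N.subgroupD(4)[of "- x"] by auto
  then have "uminus ` (uminus ` U \<inter> K) = U \<inter> K"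
    unfolding uminus_image_eq_vimage by auto
  moreover have "measure M C \<le> measure N (uminus ` (uminus ` U \<inter> K))"
  proof (rule invariant_measure_le_inverse_open[OF assms(1) N.invariant_prob_axioms assms(3,4)])
    show "open (uminus ` U)" unfolding uminus_image_eq_vimage using U(1) cont by (intro open_vimage)
    show "C \<subseteq> uminus ` U" using U(2) by (force simp: uminus_image_eq_vimage)
  qed
  ultimately show "measure M C \<le> measure N (uminus ` C) + e" using U(3) by simp
qed

text \<open>Applying the closed-set inequality once from \<open>M\<close> to \<open>N\<close> and
  once from \<open>N\<close> to itself cancels the inversion. By symmetry the measures agree on
  closed sets, an intersection-stable generator.\<close>

lemma haar_prob_unique:
  fixes K :: "'b::{group_add,topological_space} set"
  assumes "haar_prob K M" "haar_prob K N"
  shows "M = N"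
proof -
  have le: "measure M C \<le> measure N C"
    if "haar_prob K M" "haar_prob K N" "closed C" "C \<subseteq> K" for M N :: "'b measure" and C
  proof -
    interpret M: haar_prob K M by fact
    interpret N: haar_prob K N by fact
    note [continuous_intros] = compact_group_continuous_minus[OF N.group]
    have cont: "continuous_on UNIV (\<lambda>x::'b. - x)" by (intro continuous_intros)
    have "closed (uminus ` C)"
      unfolding uminus_image_eq_vimage using that cont by (intro closed_vimage)
    moreover have "uminus ` C \<subseteq> K" using that N.subgroupD(4) by auto
    ultimately have "measure N (uminus ` C) \<le> measure N (uminus ` uminus ` C)"
      by (rule invariant_measure_le_inverse_closed[OF N.invariant_prob_axioms that(2)])
    then have "measure N (uminus ` C) \<le> measure N C" by (simp add: image_image)
    with invariant_measure_le_inverse_closed[OF M.invariant_prob_axioms that(2-4)]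
    show ?thesis by simp
  qed
  interpret M: haar_prob K M by fact
  interpret N: haar_prob K N by fact
  have eq: "emeasure M C = emeasure N C" if "closed C" "C \<subseteq> K" for C
    using le[OF assms that] le[OF assms(2,1) that]
    by (simp add: M.emeasure_eq_measure N.emeasure_eq_measure)
  have meas: "id \<in> M \<rightarrow>\<^sub>M borel" "id \<in> N \<rightarrow>\<^sub>M borel"
    by (auto intro!: measurableI simp: M.sets_iff N.sets_iff M.space_eq N.space_eq M.subgroupD(1) borel_closed)
  \<comment> \<open>Pushing both measures to the whole space lets the closed sets of the ambient
    type serve as generator, with \<open>UNIV\<close> as the exhausting set.\<close>
  have "distr M borel id = distr N borel id"
  proof (rule measure_eqI_generator_eq[where E = "Collect closed" and \<Omega> = UNIV and A = "\<lambda>_. UNIV"])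
    fix C :: "'b set" assume "C \<in> Collect closed"
    then show "emeasure (distr M borel id) C = emeasure (distr N borel id) C"
      using meas M.subgroupD(1) eq[of "C \<inter> K"]
      by (simp add: emeasure_distr borel_closed M.space_eq N.space_eq closed_Int)
  qed (use meas in \<open>auto simp: Int_stable_def borel_eq_closed emeasure_distr M.emeasure_K M.space_eq\<close>)
  then have d: "emeasure (distr M borel id) A = emeasure (distr N borel id) A" for A by simp
  show ?thesis
  proof (rule measure_eqI)
    show "sets M = sets N" by (simp add: M.sets_eq N.sets_eq)
    fix A assume "A \<in> sets M"
    then show "emeasure M A = emeasure N A"
      using d[of A] meas by (simp add: emeasure_distr M.sets_iff M.space_eq N.space_eq inf.absorb1)
  qed
qed

section \<open>Regularity of Haar measure and its images under homomorphisms\<close>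

lemma normalized_haar_invariant_prob:
  fixes K :: "'b::{group_add,topological_space} set"
  assumes "compact_top_group TYPE('b)" "closed_subgroup K" "normalized_haar K M"
  shows "invariant_prob K M"
  using assms by unfold_locales (auto simp: normalized_haar_def)

lemma normalized_haar_outer_regular:
  fixes K :: "'b::{group_add,topological_space} set"
  assumes "compact_top_group TYPE('b)" "closed_subgroup K" "normalized_haar K M"
    and "A \<in> sets M" "0 < e"
  shows "\<exists>U. open U \<and> A \<subseteq> U \<and> measure M (U \<inter> K) < measure M A + e"
proof -
  interpret invariant_prob K M using assms(1-3) by (rule normalized_haar_invariant_prob)
  have "(INF U\<in>{U. openin (top_of_set K) U \<and> A \<subseteq> U}. emeasure M U) = emeasure M A"
    using assms(3,4) by (simp add: normalized_haar_def)
  also have "\<dots> < ennreal (measure M A + e)"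
    using assms(5) by (simp add: emeasure_eq_measure ennreal_lessI add_nonneg_pos)
  finally obtain U where "openin (top_of_set K) U" "A \<subseteq> U" "emeasure M U < ennreal (measure M A + e)"
    by (auto simp: INF_less_iff)
  moreover from this obtain T where "open T" "U = T \<inter> K" by (auto simp: openin_open)
  ultimately show ?thesis
    by (intro exI[of _ T]) (auto simp: emeasure_eq_measure ennreal_less_iff)
qed

lemma normalized_haar_inner_regular:
  fixes K :: "'b::{group_add,topological_space} set"
  assumes "compact_top_group TYPE('b)" "closed_subgroup K" "normalized_haar K M"
    and "open U" "0 < e"
  shows "\<exists>Q. compact Q \<and> Q \<subseteq> U \<inter> K \<and> measure M (U \<inter> K) < measure M Q + e"
proof (rule ccontr)
  interpret invariant_prob K M using assms(1-3) by (rule normalized_haar_invariant_prob)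
  define m where "m = measure M (U \<inter> K)"
  assume "\<not> ?thesis"
  then have le: "measure M Q \<le> m - e" if "compact Q" "Q \<subseteq> U \<inter> K" for Q
    using that unfolding m_def by (meson le_diff_eq linorder_not_less)
  \<comment> \<open>The empty set shows that \<open>m - e\<close> is nonnegative, so
    \<open>ennreal\<close> does not truncate it below.\<close>
  from le[of "{}"] have nn: "0 \<le> m - e" by simp
  have "openin (top_of_set K) (U \<inter> K)" using assms(4) by (auto simp: openin_open)
  then have "emeasure M (U \<inter> K) = (SUP C\<in>{C. compact C \<and> C \<subseteq> U \<inter> K}. emeasure M C)"
    using assms(3) by (simp add: normalized_haar_def)
  also have "\<dots> \<le> ennreal (m - e)"
    using le by (intro SUP_least) (auto simp: emeasure_eq_measure intro!: ennreal_leI)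
  finally show False using assms(5) nn by (simp add: emeasure_eq_measure m_def)
qed

text \<open>An open set upstairs need not be a preimage, so outer regularity does not push forward
  directly. Inner regularity does the work: a compact \<open>Q\<close> of nearly full measure in the
  preimage of the complement of \<open>C\<close> has a closed image missing \<open>C\<close>, and
  the complement of that image is the required neighbourhood.\<close>

lemma haar_prob_image:
  fixes K :: "'b::{group_add,topological_space} set" and L :: "'c::{group_add,topological_space} set"
  assumes groups: "compact_top_group TYPE('b)" "compact_top_group TYPE('c)"
    and subgroups: "closed_subgroup K" "closed_subgroup L"
    and haar: "normalized_haar K M"
    and compact_closed: "\<And>Q :: 'c set. compact Q \<Longrightarrow> closed Q"
    and cont: "continuous_on UNIV \<phi>"
    and onto: "\<phi> ` K = L"
    and hom: "\<And>x y. x \<in> K \<Longrightarrow> y \<in> K \<Longrightarrow> \<phi> (x + y) = \<phi> x + \<phi> y"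
  shows "haar_prob L (distr M (restrict_space borel L) \<phi>)"
proof -
  interpret M: invariant_prob K M
    using groups(1) subgroups(1) haar by (rule normalized_haar_invariant_prob)
  let ?N = "distr M (restrict_space borel L) \<phi>"
  have \<phi>_borel: "\<phi> \<in> borel_measurable borel" using cont by (rule borel_measurable_continuous_onI)
  have closedL: "closed L" using subgroups by (simp add: closed_subgroup_def)
  have setsL: "A \<in> sets (restrict_space borel L) \<longleftrightarrow> A \<subseteq> L \<and> A \<in> sets borel" for A
    using closedL by (subst sets_restrict_space_iff) auto
  have vim: "\<phi> -` A \<inter> K \<in> sets M" if "A \<in> sets borel" for A
    using measurable_sets[OF \<phi>_borel that] M.subgroupD(1) by (auto simp: M.sets_iff)
  have meas: "\<phi> \<in> M \<rightarrow>\<^sub>M restrict_space borel L"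
    by (rule measurableI) (use vim onto in \<open>auto simp: setsL M.space_eq space_restrict_space\<close>)
  have measN: "measure ?N A = measure M (\<phi> -` A \<inter> K)" "emeasure ?N A = emeasure M (\<phi> -` A \<inter> K)"
    if "A \<subseteq> L" "A \<in> sets borel" for A
    using that meas by (simp_all add: measure_distr emeasure_distr setsL M.space_eq)
  show ?thesis
  proof
    have "\<phi> -` L \<inter> K = K" using onto by auto
    then show "emeasure ?N L = 1" using closedL measN(2)[of L] by (simp add: M.emeasure_K)
  next
    fix g A assume g: "g \<in> L" and "A \<in> sets ?N"
    then have A: "A \<subseteq> L" "A \<in> sets borel" by (simp_all add: setsL)
    \<comment> \<open>Invariance is transferred through a lift \<open>k\<close> of \<open>g\<close>:
      the preimage in \<open>K\<close> of the translate by \<open>g\<close> is the translate by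
      \<open>k\<close> of the preimage.\<close>
    obtain k where k: "k \<in> K" "g = \<phi> k" using g onto by auto
    have \<phi>m: "\<phi> (- k + x) = - g + \<phi> x" if "x \<in> K" for x
      using hom[of k "- k + x"] that k M.subgroupD by (simp add: add.assoc[symmetric])
    have K_iff: "- k + x \<in> K \<longleftrightarrow> x \<in> K" for x
      using M.subgroupD(3)[of k "- k + x"] M.subgroupD(3)[of "- k" x] M.subgroupD(4) k(1)
      by (auto simp: add.assoc[symmetric])
    have gA: "(\<lambda>x. g + x) ` A \<subseteq> L" using g A subgroups by (auto simp: closed_subgroup_def)
    have "(\<lambda>x. - g + x) \<in> borel_measurable borel"
      by (intro borel_measurable_continuous_onI compact_group_continuous_add[OF groups(2)] continuous_intros)
    from measurable_sets[OF this A(2)] have gA': "(\<lambda>x. g + x) ` A \<in> sets borel"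
      by (simp add: translate_eq_vimage)
    have "\<phi> -` ((\<lambda>x. g + x) ` A) \<inter> K = (\<lambda>x. k + x) ` (\<phi> -` A \<inter> K)"
      unfolding translate_eq_vimage using \<phi>m K_iff by auto
    then show "emeasure ?N ((\<lambda>x. g + x) ` A) = emeasure ?N A"
      using M.emeasure_translate[OF k(1) vim[OF A(2)]] measN(2)[OF gA gA'] measN(2)[OF A] by simp
  next
    fix C and e :: real assume C: "closed C" "C \<subseteq> L" and e: "0 < e"
    define O' where "O' = \<phi> -` (- C)"
    have "open O'" unfolding O'_def using C(1) cont by (intro open_vimage) auto
    from normalized_haar_inner_regular[OF groups(1) subgroups(1) haar this e]
    obtain Q where Q: "compact Q" "Q \<subseteq> O' \<inter> K" "measure M (O' \<inter> K) < measure M Q + e"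
      by auto
    have clQ: "closed (\<phi> ` Q)"
      using Q(1) cont continuous_on_subset compact_continuous_image compact_closed by blast
    have C_sets: "\<phi> -` C \<inter> K \<in> sets M" using C by (intro vim) auto
    have Q_sets: "\<phi> -` (\<phi> ` Q) \<inter> K \<in> sets M" using clQ by (intro vim) auto
    have "measure M (O' \<inter> K) = 1 - measure M (\<phi> -` C \<inter> K)"
    proof -
      have "O' \<inter> K = space M - \<phi> -` C \<inter> K" by (auto simp: O'_def M.space_eq)
      then show ?thesis using M.finite_measure_compl[OF C_sets] by (simp add: M.space_eq M.measure_K)
    qed
    moreover have "measure M (\<phi> -` (- \<phi> ` Q \<inter> L) \<inter> K) \<le> 1 - measure M Q"
    proof -
      have "\<phi> -` (- \<phi> ` Q \<inter> L) \<inter> K = space M - \<phi> -` (\<phi> ` Q) \<inter> K" using onto by (auto simp: M.space_eq)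
      then have "measure M (\<phi> -` (- \<phi> ` Q \<inter> L) \<inter> K) = 1 - measure M (\<phi> -` (\<phi> ` Q) \<inter> K)"
        using M.finite_measure_compl[OF Q_sets] by (simp add: M.space_eq M.measure_K)
      moreover have "measure M Q \<le> measure M (\<phi> -` (\<phi> ` Q) \<inter> K)"
        using Q(2) Q_sets by (intro M.finite_measure_mono) auto
      ultimately show ?thesis by simp
    qed
    moreover have "measure ?N (- \<phi> ` Q \<inter> L) = measure M (\<phi> -` (- \<phi> ` Q \<inter> L) \<inter> K)"
      using clQ closedL by (intro measN) auto
    moreover have "measure ?N C = measure M (\<phi> -` C \<inter> K)"
      using C by (intro measN) auto
    ultimately have "measure ?N (- \<phi> ` Q \<inter> L) < measure ?N C + e" using Q(3) by simp
    moreover have "C \<subseteq> - \<phi> ` Q" using Q(2) by (auto simp: O'_def)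
    ultimately show "\<exists>U. open U \<and> C \<subseteq> U \<and> measure ?N (U \<inter> L) < measure ?N C + e"
      using clQ by (intro exI[of _ "- \<phi> ` Q"]) auto
  qed (use groups subgroups closedL in \<open>auto simp: space_restrict_space\<close>)
qed

section \<open>Finite transversals\<close>

text \<open>If no separated subset of \<open>H\<close> reaches \<open>1 / card S < e\<close>, all of
  them have at most \<open>1 / e\<close> elements, and one of maximal size is complete, since a
  missed \<open>h\<close> could be added. Finite and infinite index are thus handled at
  once.\<close>

lemma finite_transversal:
  fixes H C :: "'a::group_add set" and e :: real
  assumes "0 \<in> H" "0 \<in> C" "\<And>x. x \<in> C \<Longrightarrow> - x \<in> C" "0 < e"
  obtains S where "finite S" "S \<subseteq> H" "S \<noteq> {}"
    "\<forall>s\<in>S. \<forall>t\<in>S. s \<noteq> t \<longrightarrow> - s + t \<notin> C"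
    "1 / card S < e \<or> (\<forall>h\<in>H. \<exists>s\<in>S. - s + h \<in> C)"
proof -
  define good where "good S \<longleftrightarrow> finite S \<and> S \<subseteq> H \<and> S \<noteq> {}
    \<and> (\<forall>s\<in>S. \<forall>t\<in>S. s \<noteq> t \<longrightarrow> - s + t \<notin> C)" for S
  show thesis
  proof (cases "\<exists>S. good S \<and> 1 / card S < e")
    case True
    then obtain S where "good S" "1 / card S < e" by blast
    then show ?thesis by (intro that[of S]) (auto simp: good_def)
  next
    case False
    have bound: "card S \<le> nat \<lceil>1 / e\<rceil>" if "good S" for S
    proof -
      have "0 < card S" using that by (auto simp: good_def card_gt_0_iff)
      moreover have "e \<le> 1 / card S" using False that by force
      ultimately have "card S \<le> 1 / e" using assms(4) by (simp add: field_simps)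
      then show ?thesis by linarith
    qed
    have "good {0}" using assms by (auto simp: good_def)
    then obtain S where S: "good S" "\<And>S'. good S' \<Longrightarrow> card S' \<le> card S"
      using ex_has_greatest_nat[of good "{0}" card "Suc (nat \<lceil>1 / e\<rceil>)"] bound
      by (auto simp: less_Suc_eq_le)
    have "\<exists>s\<in>S. - s + h \<in> C" if h: "h \<in> H" for h
    proof (rule ccontr)
      assume no: "\<not> (\<exists>s\<in>S. - s + h \<in> C)"
      then have "h \<notin> S" using assms(2) by force
      moreover have "- h + s \<notin> C" if "s \<in> S" for s
        using no that assms(3)[of "- h + s"] by (auto simp: minus_add)
      ultimately have "good (insert h S)" using S(1) no h by (auto simp: good_def)
      from S(2)[OF this] show False using \<open>h \<notin> S\<close> S(1) by (simp add: good_def)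
    qed
    with S(1) show ?thesis by (intro that[of S]) (auto simp: good_def)
  qed
qed

section \<open>Groups of tuples and continuity of commutators\<close>

lemma closed_subgroup_Pi:
  fixes G :: "'i \<Rightarrow> 'a::{group_add,t2_space} set"
  assumes "\<And>i. closed_subgroup (G i)"
  shows "closed_subgroup {f. \<forall>i. f i \<in> G i}"
proof -
  have "closed ((\<lambda>f. f i) -` G i)" for i
    using assms by (intro closed_vimage) (auto simp: closed_subgroup_def)
  then have "closed (\<Inter>i. (\<lambda>f. f i) -` G i)" by auto
  moreover have "(\<Inter>i. (\<lambda>f. f i) -` G i) = {f. \<forall>i. f i \<in> G i}" by auto
  ultimately show ?thesis using assms by (simp add: closed_subgroup_def)
qed

lemma closed_subgroup_rel_tuples:
  assumes "closed_subgroup (H :: 'a::{group_add,t2_space} set)"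
  shows "closed_subgroup (rel_tuples H n)"
proof -
  have "rel_tuples H n = {f. \<forall>i. f i \<in> (if i < n then H else if i = n then UNIV else {0})}"
    by (auto simp: rel_tuples_def)
  moreover have "closed_subgroup (if i < n then H else if i = n then UNIV else {0})" for i
    using assms by (auto simp: closed_subgroup_def)
  ultimately show ?thesis by (simp only: closed_subgroup_Pi)
qed

lemma closed_subgroup_pow_tuples:
  assumes "closed_subgroup (H :: 'a::{group_add,t2_space} set)"
  shows "closed_subgroup (pow_tuples H n)"
proof -
  have "pow_tuples H n = {f. \<forall>i. f i \<in> (if i \<le> n then H else {0})}"
    by (auto simp: pow_tuples_def not_le)
  moreover have "closed_subgroup (if i \<le> n then H else {0})" for i
    using assms by (auto simp: closed_subgroup_def)
  ultimately show ?thesis by (simp only: closed_subgroup_Pi)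
qed

lemma continuous_on_fun_upd_pair:
  "continuous_on UNIV (\<lambda>p::('i \<Rightarrow> 'a::topological_space) \<times> 'a. (fst p)(i := snd p))"
proof (rule continuous_on_coordinatewise_then_product)
  fix j
  show "continuous_on UNIV (\<lambda>p::('i \<Rightarrow> 'a) \<times> 'a. ((fst p)(i := snd p)) j)"
    by (cases "j = i")
      (simp_all add: continuous_on_product_then_coordinatewise continuous_on_fst continuous_on_snd)
qed

lemma continuous_on_fun_upd_const:
  "continuous_on UNIV (\<lambda>f::'i \<Rightarrow> 'a::topological_space. f(i := a))"
proof -
  have "continuous_on UNIV (\<lambda>f::'i \<Rightarrow> 'a. (f, a))" by (intro continuous_intros)
  from continuous_on_compose2[OF continuous_on_fun_upd_pair this] show ?thesis by simp
qed

text \<open>The start value is an arbitrary continuous \<open>g\<close>, so that the induction can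
  absorb each commutator into it.\<close>

lemma continuous_on_foldl_comm:
  fixes g :: "('i \<Rightarrow> 'a::{group_add,t2_space}) \<Rightarrow> 'a"
  assumes "compact_top_group TYPE('a)" "continuous_on UNIV g"
  shows "continuous_on UNIV (\<lambda>f. foldl comm (g f) (map f xs))"
  using assms(2)
proof (induction xs arbitrary: g)
  case (Cons i xs)
  have "continuous_on UNIV (\<lambda>f. comm (g f) (f i))"
    unfolding comm_def
    by (intro compact_group_continuous_add compact_group_continuous_minus assms(1) Cons.prems) simp_all
  from Cons.IH[OF this] show ?case by simp
qed simp

text \<open>This turns the fibre of the commuting set over fixed earlier entries into a
  centralizer.\<close>

lemma comm_eq_0_iff: "comm x y = 0 \<longleftrightarrow> x + y = y + (x :: 'a::group_add)"
proof -
  have "comm x y = - (y + x) + (x + y)" by (simp add: comm_def minus_add add.assoc)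
  then show ?thesis by (simp add: add_eq_0_iff)
qed

lemma commute_minus:
  assumes "x + y = y + (x :: 'a::group_add)"
  shows "x + - y = - y + x"
proof -
  have "x + - y = - y + (y + x) + - y" by (simp only: minus_add_cancel)
  also have "\<dots> = - y + x" by (simp only: assms[symmetric] add.assoc add.right_inverse add.right_neutral)
  finally show ?thesis .
qed

section \<open>Comparison of the fibres near one point\<close>

text \<open>Here \<open>r\<close> is a common local density: up to \<open>e\<close> it bounds the
  commuting set in \<open>rel_tuples H n\<close> from above, and it bounds \<open>U\<close> in
  \<open>pow_tuples H n\<close> from below. It is 0 if \<open>1 / card S < e\<close>, and otherwise
  \<open>1 / card S\<close> for a complete transversal \<open>S\<close>. Admitting every Borel
  \<open>B\<close> inside \<open>V\<close> allows \<open>V\<close> to be cut into cells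
  later.\<close>

lemma local_degree_comparison:
  fixes H :: "'a::{group_add,t2_space} set" and n :: nat
    and c :: "(nat \<Rightarrow> 'a) \<Rightarrow> 'a" and e :: real
  defines "\<pi> \<equiv> \<lambda>f::nat \<Rightarrow> 'a. f(n := 0)"
  assumes group: "compact_top_group TYPE('a)" and sub: "closed_subgroup H"
    and inv: "invariant_prob (rel_tuples H n) M1" "invariant_prob (pow_tuples H n) M2"
    and c: "continuous_on UNIV c" "\<And>f a. c (f(n := a)) = c f"
    and U: "open U" "{f \<in> pow_tuples H n. c f + f n = f n + c f} \<subseteq> U"
    and p: "p \<in> pow_tuples H n" and e: "0 < e"
  shows "\<exists>r V. 0 \<le> r \<and> open V \<and> p \<in> V \<and> (\<forall>B\<in>sets borel. B \<subseteq> V \<longrightarrow>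
      measure M1 ({f \<in> rel_tuples H n. c f + f n = f n + c f} \<inter> \<pi> -` B)
        \<le> (r + e) * measure M1 (rel_tuples H n \<inter> \<pi> -` B)
    \<and> r * measure M2 (pow_tuples H n \<inter> \<pi> -` B) \<le> measure M2 (U \<inter> pow_tuples H n \<inter> \<pi> -` B))"
proof -
  let ?K1 = "rel_tuples H n" and ?K2 = "pow_tuples H n"
  interpret M1: invariant_prob ?K1 M1 by fact
  interpret M2: invariant_prob ?K2 M2 by fact
  note cadd = compact_group_continuous_add[OF group]
  have H: "0 \<in> H" "\<And>x y. x \<in> H \<Longrightarrow> y \<in> H \<Longrightarrow> x + y \<in> H" "\<And>x. x \<in> H \<Longrightarrow> - x \<in> H" "closed H"
    using sub by (auto simp: closed_subgroup_def)
  define D where "D = {f. c f + f n = f n + c f}"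
  have D1: "{f \<in> ?K1. c f + f n = f n + c f} = ?K1 \<inter> D" by (auto simp: D_def)
  have "closed D"
    unfolding D_def by (intro closed_Collect_eq cadd c) simp_all
  then have D_borel: "D \<in> sets borel" by simp
  \<comment> \<open>The centralizer of \<open>c p\<close> in the whole group. For elements of
    \<open>H\<close>, distinct cosets of \<open>C\<close> and of its intersection with
    \<open>H\<close> mean the same, so one \<open>S\<close> serves both groups.\<close>
  define C where "C = {k. c p + k = k + c p}"
  have closedC: "closed C"
    unfolding C_def by (intro closed_Collect_eq cadd continuous_on_const continuous_on_id)
  have \<pi>_borel: "\<pi> -` B \<in> sets borel" if "B \<in> sets borel" for B
    using measurable_sets[OF borel_measurable_continuous_onI[OF continuous_on_fun_upd_const] that, of n 0]
    by (simp add: \<pi>_def)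
  have C0: "0 \<in> C" by (simp add: C_def)
  have C_minus: "- x \<in> C" if "x \<in> C" for x
    using that commute_minus[of "c p" x] by (simp add: C_def)
  obtain S where S: "finite S" "S \<subseteq> H" "S \<noteq> {}"
      "\<forall>s\<in>S. \<forall>t\<in>S. s \<noteq> t \<longrightarrow> - s + t \<notin> C"
      "1 / card S < e \<or> (\<forall>h\<in>H. \<exists>s\<in>S. - s + h \<in> C)"
    by (rule finite_transversal[OF H(1) C0 C_minus e])
  have cardS: "0 < card S" using S by (simp add: card_gt_0_iff)
  \<comment> \<open>Adding \<open>E k\<close> on the left changes coordinate \<open>n\<close> only,
    so these translations preserve the fibres of \<pi>.\<close>
  define E where "E k = (0 :: nat \<Rightarrow> 'a)(n := k)" for k
  have E_add: "E k + f = f(n := k + f n)" for k f by (auto simp: E_def)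
  have E_K: "E ` S \<subseteq> ?K1" "E ` S \<subseteq> ?K2"
    using S(2) H(1) by (auto simp: E_def rel_tuples_def pow_tuples_def)
  \<comment> \<open>Separation of \<open>S\<close> by the centralizer of \<open>c q\<close> amounts
    to finitely many inequations in \<open>q\<close>, hence is an open condition.\<close>
  define V1 where "V1 = (\<Inter>s\<in>S. \<Inter>t\<in>S - {s}. {q. c q + (- s + t) \<noteq> (- s + t) + c q})"
  have "open V1"
    unfolding V1_def
    by (intro open_INT ballI finite_Diff S(1) open_Collect_neq cadd c(1) continuous_on_const)
  have "p \<in> V1" using S(4) by (auto simp: V1_def C_def)
  have upper: "measure M1 (?K1 \<inter> D \<inter> \<pi> -` B) \<le> 1 / card S * measure M1 (?K1 \<inter> \<pi> -` B)"
    if B: "B \<in> sets borel" "B \<subseteq> V1" for B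
  proof -
    let ?X = "?K1 \<inter> D \<inter> \<pi> -` B"
    have "card S * measure M1 ?X \<le> measure M1 (?K1 \<inter> \<pi> -` B)"
    proof (rule M1.card_mult_measure_le[OF S(1) E_K(1)])
      show "?X \<in> sets M1" "?K1 \<inter> \<pi> -` B \<in> sets M1"
        using M1.subgroupD(1) D_borel \<pi>_borel[OF B(1)] by (auto simp: M1.sets_iff)
      show "(\<lambda>x. E s + x) ` ?X \<subseteq> ?K1 \<inter> \<pi> -` B" if "s \<in> S" for s
        using that E_K(1) M1.subgroupD(3) by (auto simp: \<pi>_def E_add) (metis E_add image_subset_iff)
      show "disjoint_family_on (\<lambda>s. (\<lambda>x. E s + x) ` ?X) S"
        unfolding disjoint_family_on_def
      proof (intro ballI impI equals0I)
        \<comment> \<open>If two translates met, \<open>- s + t\<close> would equal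
          \<open>f n + - g n\<close>, where both entries commute with \<open>c f = c g\<close>; so
          \<open>- s + t\<close> would too, against the choice of \<open>V1\<close>.\<close>
        fix s t x assume st: "s \<in> S" "t \<in> S" "s \<noteq> t"
          and "x \<in> (\<lambda>x. E s + x) ` ?X \<inter> (\<lambda>x. E t + x) ` ?X"
        then obtain f g where fg: "f \<in> ?X" "g \<in> ?X" "f(n := s + f n) = g(n := t + g n)"
          by (auto simp: E_add)
        have "s + f n = t + g n" using fg(3) by (metis fun_upd_same)
        then have "- s + (s + f n) + - g n = - s + (t + g n) + - g n" by simp
        then have st_eq: "- s + t = f n + - g n"
          by (simp only: add.assoc minus_add_cancel add.right_inverse add.right_neutral)
        have "c f = c g" using fg(3) c(2) by metis
        have "\<pi> f \<in> V1" using fg(1) B by auto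
        then have "c (\<pi> f) + (- s + t) \<noteq> (- s + t) + c (\<pi> f)"
          using st by (auto simp: V1_def)
        then have ne: "c f + (f n + - g n) \<noteq> f n + - g n + c f" by (simp add: st_eq \<pi>_def c(2))
        have 1: "c f + f n = f n + c f" "c f + - g n = - g n + c f"
          using fg commute_minus \<open>c f = c g\<close> by (auto simp: D_def)
        have "c f + (f n + - g n) = f n + (c f + - g n)"
          using 1(1) by (simp only: add.assoc[symmetric])
        also have "\<dots> = f n + - g n + c f" by (simp only: 1(2) add.assoc)
        finally show False using ne by simp
      qed
    qed
    then show ?thesis using cardS by (simp add: field_simps)
  qed
  show ?thesis
  proof (cases "1 / card S < e")
    case True
    \<comment> \<open>With \<open>r = 0\<close> the lower bound is trivial and \<open>e\<close>
      alone absorbs the upper one.\<close>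
    have "measure M1 (?K1 \<inter> D \<inter> \<pi> -` B) \<le> (0 + e) * measure M1 (?K1 \<inter> \<pi> -` B)"
      if B: "B \<in> sets borel" "B \<subseteq> V1" for B
      using upper[OF B] mult_right_mono[OF less_imp_le[OF True] measure_nonneg[of M1 "?K1 \<inter> \<pi> -` B"]]
      by simp
    then show ?thesis unfolding D1
      using \<open>open V1\<close> \<open>p \<in> V1\<close> by (intro exI[of _ 0] exI[of _ V1]) auto
  next
    case False
    then have complete: "\<forall>h\<in>H. \<exists>s\<in>S. - s + h \<in> C" using S(5) by blast
    \<comment> \<open>Centralizers at nearby points may be smaller than \<open>C\<close>, so
      \<open>C\<close> stays that of \<open>p\<close> and the target is the open set
      \<open>U\<close> instead of the commuting set. Compactness of the fibre over \<open>p\<close>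
      provides the neighbourhood.\<close>
    have "\<exists>V. p \<in> V \<and> open V \<and> V \<times> (C \<inter> H) \<subseteq> {q. (fst q)(n := snd q) \<in> U}"
    proof (rule Elementary_Topology.tube_lemma)
      have "compact (UNIV :: 'a set)" using group by (simp add: compact_top_group_def)
      then show "compact (C \<inter> H)"
        using compact_Int_closed[of UNIV "C \<inter> H"] closedC H(4) by auto
      show "open {q. (fst q)(n := snd q) \<in> U}"
        using open_vimage[OF U(1) continuous_on_fun_upd_pair[of n]] by (simp add: vimage_def)
      have "p(n := k) \<in> U" if "k \<in> C \<inter> H" for k
        using that p by (intro subsetD[OF U(2)]) (auto simp: pow_tuples_def C_def c(2))
      then show "{p} \<times> (C \<inter> H) \<subseteq> {q. (fst q)(n := snd q) \<in> U}" by auto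
    qed
    then obtain V2 where V2: "p \<in> V2" "open V2" "V2 \<times> (C \<inter> H) \<subseteq> {q. (fst q)(n := snd q) \<in> U}"
      by blast
    have lower: "1 / card S * measure M2 (?K2 \<inter> \<pi> -` B) \<le> measure M2 (U \<inter> ?K2 \<inter> \<pi> -` B)"
      if B: "B \<in> sets borel" "B \<subseteq> V2" for B
    proof -
      \<comment> \<open>Over \<open>B\<close> this set lies in \<open>U\<close>, and its translates
        by the complete transversal \<open>S\<close> cover everything.\<close>
      let ?X = "?K2 \<inter> (\<lambda>f. f n) -` C \<inter> \<pi> -` B"
      have "closed ((\<lambda>f::nat \<Rightarrow> 'a. f n) -` C)" using closedC by (intro closed_vimage) auto
      then have X: "?X \<in> sets M2"
        using M2.subgroupD(1) \<pi>_borel[OF B(1)] by (auto simp: M2.sets_iff)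
      have "measure M2 (?K2 \<inter> \<pi> -` B) \<le> card S * measure M2 ?X"
      proof (rule M2.measure_le_card_mult[OF S(1) E_K(2) X], rule subsetI)
        fix f assume f: "f \<in> ?K2 \<inter> \<pi> -` B"
        then have "f n \<in> H" by (auto simp: pow_tuples_def)
        then obtain s where s: "s \<in> S" "- s + f n \<in> C" using complete by blast
        have "f(n := - s + f n) \<in> ?X"
          using f s S(2) H by (auto simp: pow_tuples_def \<pi>_def)
        moreover have "f = E s + f(n := - s + f n)" by (simp add: E_add add.assoc[symmetric])
        ultimately show "f \<in> (\<Union>s\<in>S. (\<lambda>x. E s + x) ` ?X)" using s(1) by blast
      qed
      also have "\<dots> \<le> card S * measure M2 (U \<inter> ?K2 \<inter> \<pi> -` B)"
      proof (intro mult_left_mono M2.finite_measure_mono)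
        show "U \<inter> ?K2 \<inter> \<pi> -` B \<in> sets M2"
          using M2.subgroupD(1) \<pi>_borel[OF B(1)] U(1) by (auto simp: M2.sets_iff)
        have "f \<in> U" if f: "f \<in> ?X" for f
        proof -
          have "(\<pi> f, f n) \<in> V2 \<times> (C \<inter> H)" using f B(2) by (auto simp: pow_tuples_def)
          then have "(\<pi> f)(n := f n) \<in> U" using V2(3) by auto
          then show ?thesis by (simp add: \<pi>_def)
        qed
        then show "?X \<subseteq> U \<inter> ?K2 \<inter> \<pi> -` B" by auto
      qed simp
      finally show ?thesis using cardS by (simp add: field_simps)
    qed
    have "measure M1 (?K1 \<inter> D \<inter> \<pi> -` B) \<le> (1 / card S + e) * measure M1 (?K1 \<inter> \<pi> -` B)"
      if B: "B \<in> sets borel" "B \<subseteq> V1" for B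
      using upper[OF B] mult_nonneg_nonneg[OF less_imp_le[OF e] measure_nonneg[of M1 "?K1 \<inter> \<pi> -` B"]]
      by (simp add: distrib_right)
    then show ?thesis unfolding D1
      using \<open>open V1\<close> \<open>p \<in> V1\<close> V2(1,2) lower
      by (intro exI[of _ "1 / card S"] exI[of _ "V1 \<inter> V2"]) auto
  qed
qed

section \<open>Passage from local to global by a partition of the first \<open>n\<close>
  coordinates\<close>

theorem theorem3p1:
  fixes H :: "'a::{group_add,t2_space} set" and n :: nat
    and MHG MH :: "(nat \<Rightarrow> 'a) measure"
  assumes "compact_group_type TYPE('a)"
    and "closed_subgroup H"
    and "n \<ge> 1"
    and "normalized_haar (rel_tuples H n) MHG"
    and "normalized_haar (pow_tuples H n) MH"
  shows "comm_degree n (rel_tuples H n) MHG \<le> comm_degree n (pow_tuples H n) MH"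
proof -
  let ?K1 = "rel_tuples H n" and ?K2 = "pow_tuples H n"
  \<comment> \<open>\<open>K0\<close> is the group of \<open>n\<close>-tuples over \<open>H\<close>,
    with indices up to \<open>n - 1\<close> and entry 0 at \<open>n\<close>; both groups of tuples
    project onto it by \<pi>.\<close>
  define K0 where "K0 = pow_tuples H (n - 1)"
  define \<pi> where "\<pi> = (\<lambda>f::nat \<Rightarrow> 'a. f(n := 0))"
  define c where "c f = ncomm (map f [0..<n])" for f :: "nat \<Rightarrow> 'a"
  have group: "compact_top_group TYPE('a)"
    using assms(1) by (simp add: compact_group_type_def compact_top_group_def)
  have group_fun: "compact_top_group TYPE(nat \<Rightarrow> 'a)"
    using assms(1) by (rule compact_top_group_fun)
  have sub1: "closed_subgroup ?K1" and sub2: "closed_subgroup ?K2" and sub0: "closed_subgroup K0"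
    using assms(2) unfolding K0_def
    by (simp_all add: closed_subgroup_rel_tuples closed_subgroup_pow_tuples)
  interpret M1: invariant_prob ?K1 MHG
    using group_fun sub1 assms(4) by (rule normalized_haar_invariant_prob)
  interpret M2: invariant_prob ?K2 MH
    using group_fun sub2 assms(5) by (rule normalized_haar_invariant_prob)

  have c_cont: "continuous_on UNIV c"
  proof -
    have "c = (\<lambda>f. foldl comm (f 0) (map f [1..<n]))"
      using assms(3) by (simp add: c_def fun_eq_iff upt_conv_Cons)
    then show ?thesis using continuous_on_foldl_comm[OF group, of "\<lambda>f. f 0"] by simp
  qed
  have c_upd: "c (f(n := a)) = c f" for f a
    unfolding c_def by (intro arg_cong[of _ _ ncomm]) simp
  have ncomm_iff: "ncomm (map f [0..<Suc n]) = 0 \<longleftrightarrow> c f + f n = f n + c f" for f :: "nat \<Rightarrow> 'a"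
  proof -
    have "ncomm (map f [0..<Suc n]) = comm (c f) (f n)"
      using assms(3) by (simp add: c_def upt_conv_Cons)
    then show ?thesis by (simp add: comm_eq_0_iff)
  qed
  define D where "D = {f. c f + f n = f n + c f}"
  have "closed D"
    unfolding D_def by (intro closed_Collect_eq compact_group_continuous_add group c_cont) simp_all
  then have D_sets: "?K1 \<inter> D \<in> sets MHG" "?K2 \<inter> D \<in> sets MH"
    using M1.subgroupD(1) M2.subgroupD(1) by (auto simp: M1.sets_iff M2.sets_iff)

  have \<pi>_cont: "continuous_on UNIV \<pi>" unfolding \<pi>_def by (rule continuous_on_fun_upd_const)
  have \<pi>_sets: "?K1 \<inter> \<pi> -` B \<in> sets MHG" "?K2 \<inter> \<pi> -` B \<in> sets MH" if "B \<in> sets borel" for B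
    using measurable_sets[OF borel_measurable_continuous_onI[OF \<pi>_cont] that]
      M1.subgroupD(1) M2.subgroupD(1) by (auto simp: M1.sets_iff M2.sets_iff)
  have H0: "0 \<in> H" using assms(2) by (simp add: closed_subgroup_def)
  have K0_iff: "f \<in> K0 \<longleftrightarrow> (\<forall>i<n. f i \<in> H) \<and> (\<forall>i\<ge>n. f i = 0)" for f
    using assms(3) unfolding K0_def pow_tuples_def
    by (auto simp: Suc_le_eq less_Suc_eq_le)
  have \<pi>_K0: "\<pi> f = f" "f \<in> ?K1" "f \<in> ?K2" if "f \<in> K0" for f
    using that H0 by (auto simp: K0_iff \<pi>_def rel_tuples_def pow_tuples_def fun_eq_iff le_less)
  have \<pi>_in: "\<pi> f \<in> K0" if "f \<in> ?K1 \<or> f \<in> ?K2" for f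
    using that by (auto simp: K0_iff \<pi>_def rel_tuples_def pow_tuples_def)
  have \<pi>_onto: "\<pi> ` ?K1 = K0" "\<pi> ` ?K2 = K0"
    using \<pi>_K0 \<pi>_in by (auto simp: image_iff) (metis \<pi>_K0)+
  have \<pi>_hom: "\<pi> (f + g) = \<pi> f + \<pi> g" for f g by (auto simp: \<pi>_def)
  \<comment> \<open>Both images under \<pi> are Haar measures on \<open>K0\<close>, so by uniqueness
    the two measures have the same marginal.\<close>
  have "haar_prob K0 (distr MHG (restrict_space borel K0) \<pi>)"
    by (rule haar_prob_image[OF group_fun group_fun sub1 sub0 assms(4)])
      (simp_all only: compact_imp_closed_fun \<pi>_cont \<pi>_onto \<pi>_hom)
  moreover have "haar_prob K0 (distr MH (restrict_space borel K0) \<pi>)"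
    by (rule haar_prob_image[OF group_fun group_fun sub2 sub0 assms(5)])
      (simp_all only: compact_imp_closed_fun \<pi>_cont \<pi>_onto \<pi>_hom)
  ultimately have distr_eq: "distr MHG (restrict_space borel K0) \<pi> = distr MH (restrict_space borel K0) \<pi>"
    by (rule haar_prob_unique)
  have closed0: "closed K0" using sub0 by (simp add: closed_subgroup_def)
  have sets0: "A \<in> sets (restrict_space borel K0) \<longleftrightarrow> A \<subseteq> K0 \<and> A \<in> sets borel" for A
    using closed0 by (subst sets_restrict_space_iff) auto
  have marginal: "measure MHG (?K1 \<inter> \<pi> -` B) = measure MH (?K2 \<inter> \<pi> -` B)"
    if B: "B \<in> sets borel" "B \<subseteq> K0" for B
  proof -
    have "\<pi> \<in> MHG \<rightarrow>\<^sub>M restrict_space borel K0" "\<pi> \<in> MH \<rightarrow>\<^sub>M restrict_space borel K0"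
      using \<pi>_sets \<pi>_in by (auto intro!: measurableI
        simp: sets0 M1.space_eq M2.space_eq space_restrict_space Int_commute)
    then have "measure (distr MHG (restrict_space borel K0) \<pi>) B = measure MHG (?K1 \<inter> \<pi> -` B)"
      "measure (distr MH (restrict_space borel K0) \<pi>) B = measure MH (?K2 \<inter> \<pi> -` B)"
      using B by (simp_all add: measure_distr sets0 M1.space_eq M2.space_eq Int_commute)
    then show ?thesis by (simp add: distr_eq)
  qed

  \<comment> \<open>One \<open>e\<close> pays for the local comparison, the other for outer
    regularity at the commuting set.\<close>
  have "measure MHG (?K1 \<inter> D) \<le> measure MH (?K2 \<inter> D) + 2 * e" if e: "0 < e" for e
  proof -
    obtain U where U: "open U" "?K2 \<inter> D \<subseteq> U" "measure MH (U \<inter> ?K2) < measure MH (?K2 \<inter> D) + e"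
      using normalized_haar_outer_regular[OF group_fun sub2 assms(5) D_sets(2) e] by blast
    have U': "{f \<in> ?K2. c f + f n = f n + c f} \<subseteq> U" using U(2) by (auto simp: D_def)
    have D1: "{f \<in> ?K1. c f + f n = f n + c f} = ?K1 \<inter> D" by (auto simp: D_def)
    have "\<exists>r V. 0 \<le> r \<and> open V \<and> p \<in> V \<and> (\<forall>B\<in>sets borel. B \<subseteq> V \<longrightarrow>
        measure MHG (?K1 \<inter> D \<inter> \<pi> -` B) \<le> (r + e) * measure MHG (?K1 \<inter> \<pi> -` B)
      \<and> r * measure MH (?K2 \<inter> \<pi> -` B) \<le> measure MH (U \<inter> ?K2 \<inter> \<pi> -` B))"
      (is "\<exists>r V. ?P p r V") if "p \<in> K0" for p
      using local_degree_comparison[OF group assms(2) M1.invariant_prob_axioms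
          M2.invariant_prob_axioms c_cont c_upd U(1) U' \<pi>_K0(3)[OF that] e]
      unfolding D1 \<pi>_def .
    then have "\<forall>p\<in>K0. \<exists>r V. ?P p r V" by (intro ballI)
    from bchoice[OF this] obtain r where "\<forall>p\<in>K0. \<exists>V. ?P p (r p) V" by (rule exE)
    from bchoice[OF this] obtain V where rV: "\<forall>p\<in>K0. 0 \<le> r p \<and> open (V p) \<and> p \<in> V p \<and> (\<forall>B\<in>sets borel. B \<subseteq> V p \<longrightarrow>
        measure MHG (?K1 \<inter> D \<inter> \<pi> -` B) \<le> (r p + e) * measure MHG (?K1 \<inter> \<pi> -` B)
      \<and> r p * measure MH (?K2 \<inter> \<pi> -` B) \<le> measure MH (U \<inter> ?K2 \<inter> \<pi> -` B))"
      by (rule exE)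
    have "compact (UNIV :: (nat \<Rightarrow> 'a) set)" using group_fun by (simp add: compact_top_group_def)
    then have "compact K0" using compact_Int_closed[of UNIV K0] closed0 by simp
    then obtain T where T: "T \<subseteq> K0" "finite T" "K0 \<subseteq> (\<Union>t\<in>T. V t)"
      by (rule compactE_image[of K0 K0 V]) (use rV in auto)
    have "\<forall>t\<in>T. V t \<inter> K0 \<in> sets borel"
      using rV T(1) closed0 by auto
    \<comment> \<open>Each cell \<open>B t\<close> lies in a single \<open>V t\<close>, so the
      density \<open>r t\<close> is valid on all of it.\<close>
    from finite_cover_refine_partition[OF T(2) this]
    obtain B where B: "\<forall>t\<in>T. B t \<in> sets borel \<and> B t \<subseteq> V t \<inter> K0" "disjoint_family_on B T"
        "(\<Union>t\<in>T. B t) = (\<Union>t\<in>T. V t \<inter> K0)"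
      by (elim exE conjE)
    have UB: "(\<Union>t\<in>T. B t) = K0" using B(3) T(3) by auto
    have K1_eq: "?K1 = (\<Union>t\<in>T. ?K1 \<inter> \<pi> -` B t)"
    proof -
      have "(\<Union>t\<in>T. ?K1 \<inter> \<pi> -` B t) = ?K1 \<inter> \<pi> -` (\<Union>t\<in>T. B t)" by blast
      then show ?thesis using UB \<pi>_in by auto
    qed
    have disj: "disjoint_family_on (\<lambda>t. A \<inter> \<pi> -` B t) T" for A
      using B(2) by (auto simp: disjoint_family_on_def)
    have sum1: "(\<Sum>t\<in>T. measure MHG (?K1 \<inter> \<pi> -` B t)) = 1"
    proof -
      have "(\<Sum>t\<in>T. measure MHG (?K1 \<inter> \<pi> -` B t)) = measure MHG (\<Union>t\<in>T. ?K1 \<inter> \<pi> -` B t)"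
        using B(1) \<pi>_sets disj by (intro M1.finite_measure_finite_Union[symmetric] T(2)) auto
      then show ?thesis using K1_eq M1.measure_K by simp
    qed
    have D\<pi>_sets: "?K1 \<inter> D \<inter> \<pi> -` B t \<in> sets MHG" if "t \<in> T" for t
    proof -
      have "(?K1 \<inter> D) \<inter> (?K1 \<inter> \<pi> -` B t) \<in> sets MHG"
        using B(1) that by (intro sets.Int D_sets \<pi>_sets) auto
      moreover have "(?K1 \<inter> D) \<inter> (?K1 \<inter> \<pi> -` B t) = ?K1 \<inter> D \<inter> \<pi> -` B t" by auto
      ultimately show ?thesis by simp
    qed
    have "measure MHG (?K1 \<inter> D) \<le> measure MHG (\<Union>t\<in>T. ?K1 \<inter> D \<inter> \<pi> -` B t)"
    proof (rule M1.finite_measure_mono)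
      show "?K1 \<inter> D \<subseteq> (\<Union>t\<in>T. ?K1 \<inter> D \<inter> \<pi> -` B t)" using K1_eq by blast
      show "(\<Union>t\<in>T. ?K1 \<inter> D \<inter> \<pi> -` B t) \<in> sets MHG" 
        using D\<pi>_sets by (intro sets.finite_UN T(2))
    qed
    also have "\<dots> \<le> (\<Sum>t\<in>T. measure MHG (?K1 \<inter> D \<inter> \<pi> -` B t))"
      using D\<pi>_sets by (intro measure_UNION_le T(2))
    also have "\<dots> \<le> (\<Sum>t\<in>T. (r t + e) * measure MHG (?K1 \<inter> \<pi> -` B t))"
      using rV B(1) T(1) by (intro sum_mono) blast
    \<comment> \<open>The common marginal replaces the weights under \<open>MHG\<close> by those
      under \<open>MH\<close>; as the weights sum to 1, the local errors add up to
      \<open>e\<close>.\<close>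
    also have "\<dots> = (\<Sum>t\<in>T. r t * measure MH (?K2 \<inter> \<pi> -` B t)) + e"
    proof -
      have "(\<Sum>t\<in>T. (r t + e) * measure MHG (?K1 \<inter> \<pi> -` B t))
          = (\<Sum>t\<in>T. r t * measure MHG (?K1 \<inter> \<pi> -` B t)) + e * (\<Sum>t\<in>T. measure MHG (?K1 \<inter> \<pi> -` B t))"
        by (simp add: distrib_right sum.distrib sum_distrib_left)
      also have "\<dots> = (\<Sum>t\<in>T. r t * measure MH (?K2 \<inter> \<pi> -` B t)) + e"
        using sum1 marginal B(1) by simp
      finally show ?thesis .
    qed
    also have "\<dots> \<le> (\<Sum>t\<in>T. measure MH (U \<inter> ?K2 \<inter> \<pi> -` B t)) + e"
      using rV B(1) T(1) by (intro add_right_mono sum_mono) blast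
    also have "(\<Sum>t\<in>T. measure MH (U \<inter> ?K2 \<inter> \<pi> -` B t)) = measure MH (\<Union>t\<in>T. U \<inter> ?K2 \<inter> \<pi> -` B t)"
      using B(1) \<pi>_sets U(1)
      by (intro M2.finite_measure_finite_Union[symmetric] T(2) disj) (auto simp: M2.sets_iff Int_assoc)
    also have "\<dots> \<le> measure MH (U \<inter> ?K2)"
      using U(1) M2.subgroupD(1) by (intro M2.finite_measure_mono) (auto simp: M2.sets_iff)
    finally show ?thesis using U(3) by simp
  qed
  then have "measure MHG (?K1 \<inter> D) \<le> measure MH (?K2 \<inter> D) + e" if "0 < e" for e
    using that by (metis half_gt_zero field_sum_of_halves mult_2)
  then have "measure MHG (?K1 \<inter> D) \<le> measure MH (?K2 \<inter> D)" by (rule field_le_epsilon)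
  moreover have "{f \<in> A. ncomm (map f [0..<Suc n]) = 0} = A \<inter> D" for A
    unfolding ncomm_iff by (auto simp: D_def)
  ultimately show ?thesis by (simp add: comm_degree_def del: upt_Suc)
qed

end
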